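(* Let $C:\mathbb{R}\to\mathbb{R}$ be a (candidate stationary) covariance function of the angular difference which is even and $2\pi$-periodic, i.e. $C(-t)=C(t)$ and $C(t+2\pi)=C(t)$ for all $t$ (so that $C(\theta-\theta')=C(d(\theta,\theta'))$ depends only on the geodesic distance $d(\theta,\theta')$ of the angles $\theta,\theta'\in\Theta=[0,2\pi)$). Suppose that $C$ admits the cosine series representation $$C(t)=a_0+\sum_{j=1}^{\infty}a_j\cos(jt),\qquad t\in[0,2\pi],$$ with real coefficients $$a_0=\frac1{2\pi}\int_0^{2\pi}C(t)\,dt,\qquad a_j=\frac1\pi\int_0^{2\pi}C(t)\cos(jt)\,dt\quad(j\ge1),$$ and that $\sum_{j\ge0}|a_j|<\infty$. Then the following statements are equivalent: (i) $C$ is positive semi-definite: for every $n\ge1$, all angles $\theta_1,\dots,\theta_n\in\Theta$ and all $b_1,\dots,b_n\in\mathbb{R}$, one has $\sum_{i,k=1}^n b_ib_k\,C(\theta_i-\theta_k)\ge0$. (ii) For every integer $N_\theta\ge1$, with $\theta_m=2\pi m/N_\theta$ for $m=0,\dots,N_\theta-1$, the circulant matrix $K^{(N_\theta)}=\big(C(\theta_m-\theta_n)\big)_{0\le m,n\le N_\theta-1}$ is positive semi-definite. (iii) $a_j\ge0$ for all $j\ge0$. In particular, if any one of (i)–(iii) holds, then $C$ is a valid covariance function on $\Theta$, and hence there exists a zero-mean stationary real-valued Gaussian process $\{\delta r(\theta)\}_{\theta\in\Theta}$ with $\operatorname{Cov}(\delta r(\theta),\delta r(\theta'))=C(\theta-\theta')$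 for all $\theta,\theta'\in\Theta$.
   Context: $\Theta=[0,2\pi)$ is the angular domain. The geodesic (shortest-arc) distance on $\Theta$ is $d(\theta,\theta')=\min\{|\theta-\theta'|,\,2\pi-|\theta-\theta'|\}\in[0,\pi]$. The standing conditions on $C$ are: stationarity ($\operatorname{Cov}(\delta r(\theta),\delta r(\theta'))=C(d(\theta,\theta'))$), dependence through the shortest arc $d$, symmetry $C(t)=C(-t)$, and periodicity $C(t)=C(2\pi+t)$; $C$ is identified with its $2\pi$-periodic extension to $\mathbb{R}$. *)

theory Defs
  imports "HOL-Probability.Probability" "Jordan_Normal_Form.Matrix"
begin

definition Angles :: "real set" where
  "Angles = {0..<2 * pi}"

definition ang_dist :: "real \<Rightarrow> real \<Rightarrow> real" where
  "ang_dist x y = min \<bar>x - y\<bar> (2 * pi - \<bar>x - y\<bar>)"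

text \<open>The points \<open>p 1, \<dots>, p n\<close> need not be distinct.\<close>

definition psd_kernel_on :: "'i set \<Rightarrow> ('i \<Rightarrow> 'i \<Rightarrow> real) \<Rightarrow> bool" where
  "psd_kernel_on S K \<longleftrightarrow>
     (\<forall>n\<ge>1. \<forall>(p :: nat \<Rightarrow> 'i) (b :: nat \<Rightarrow> real). (\<forall>i\<in>{1..n}. p i \<in> S) \<longrightarrow>
        0 \<le> (\<Sum>i=1..n. \<Sum>k=1..n. b i * b k * K (p i) (p k)))"

definition valid_covariance_on :: "'i set \<Rightarrow> ('i \<Rightarrow> 'i \<Rightarrow> real) \<Rightarrow> bool" where
  "valid_covariance_on S K \<longleftrightarrow> (\<forall>x\<in>S. \<forall>y\<in>S. K x y = K y x) \<and> psd_kernel_on S K"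

definition psd_mat :: "real mat \<Rightarrow> bool" where
  "psd_mat A \<longleftrightarrow> square_mat A \<and> transpose_mat A = A \<and>
     (\<forall>v \<in> carrier_vec (dim_row A). 0 \<le> scalar_prod v (mult_mat_vec A v))"

definition grid_angle :: "nat \<Rightarrow> nat \<Rightarrow> real" where
  "grid_angle N m = 2 * pi * real m / real N"

definition grid_mat :: "(real \<Rightarrow> real) \<Rightarrow> nat \<Rightarrow> real mat" where
  "grid_mat C N = mat N N (\<lambda>(m, n). C (grid_angle N m - grid_angle N n))"

definition covariance :: "'w measure \<Rightarrow> ('w \<Rightarrow> real) \<Rightarrow> ('w \<Rightarrow> real) \<Rightarrow> real" where
  "covariance M X Y =
     (\<integral>w. (X w - (\<integral>v. X v \<partial>M)) * (Y w - (\<integral>v. Y v \<partial>M)) \<partial>M)"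

text \<open>The normal law with mean \<open>\<mu>\<close> and standard deviation \<open>\<sigma> \<ge> 0\<close>; for \<open>\<sigma> = 0\<close> it is the
  point mass at \<open>\<mu>\<close>.  The degenerate case is needed because a positive semi-definite
  covariance may be singular.\<close>

definition normal_law :: "real \<Rightarrow> real \<Rightarrow> real measure" where
  "normal_law \<mu> \<sigma> =
     (if \<sigma> = 0 then return borel \<mu> else density lborel (\<lambda>x. ennreal (normal_density \<mu> \<sigma> x)))"

text \<open>A process is Gaussian when all its finite linear combinations are normal. In particular all
  \<open>X t\<close> are square-integrable, so the integrals in \<^const>\<open>covariance\<close> exist.\<close>

definition gaussian_process :: "'w measure \<Rightarrow> 'i set \<Rightarrow> ('i \<Rightarrow> 'w \<Rightarrow> real) \<Rightarrow> bool" where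
  "gaussian_process M T X \<longleftrightarrow>
     prob_space M \<and>
     (\<forall>t\<in>T. X t \<in> borel_measurable M) \<and>
     (\<forall>F c. finite F \<and> F \<subseteq> T \<longrightarrow>
        (\<exists>\<mu> \<sigma>. 0 \<le> \<sigma> \<and> distr M borel (\<lambda>w. \<Sum>t\<in>F. c t * X t w) = normal_law \<mu> \<sigma>))"

definition zero_mean_process :: "'w measure \<Rightarrow> 'i set \<Rightarrow> ('i \<Rightarrow> 'w \<Rightarrow> real) \<Rightarrow> bool" where
  "zero_mean_process M T X \<longleftrightarrow> (\<forall>t\<in>T. (\<integral>w. X t w \<partial>M) = 0)"

text \<open>Second-order stationarity on the circle: constant mean, and a covariance that is a function
  of the shortest-arc distance.\<close>

definition stationary_on_circle :: "'w measure \<Rightarrow> (real \<Rightarrow> 'w \<Rightarrow> real) \<Rightarrow> bool" where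
  "stationary_on_circle M X \<longleftrightarrow>
     (\<exists>m. \<forall>x\<in>Angles. (\<integral>w. X x w \<partial>M) = m) \<and>
     (\<exists>R. \<forall>x\<in>Angles. \<forall>y\<in>Angles. covariance M (X x) (X y) = R (ang_dist x y))"

end

theory Submission
  imports Defs
begin

text \<open>Everything rests on the addition formula for \<open>cos (j (x - y))\<close>: the quadratic form of the kernel
  \<open>cos (j (x - y))\<close> is a sum of two squares (\<open>sum_sum_cos_diff\<close>). Hence a cosine series with
  nonnegative coefficients is a convergent sum of positive semi-definite kernels, which is the step
  from the coefficients to the kernel; restricting the kernel to the grid angles gives the matrices.

  The step from the matrices back to the coefficients recovers \<open>a j\<close> by a discrete Fourier
  transform. Testing the matrix of size \<open>N\<close> against the vectors \<open>cos (j \<theta>\<^sub>m)\<close> and \<open>sin (j \<theta>\<^sub>m)\<close>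
  and adding the two forms gives the nonnegative double average of
  \<open>cos (j (\<theta>\<^sub>m - \<theta>\<^sub>n)) C (\<theta>\<^sub>m - \<theta>\<^sub>n)\<close>.
  Inserting the series for \<open>C\<close>, orthogonality of the characters of the cyclic group of order \<open>N\<close>
  removes every frequency \<open>l \<noteq> j\<close> with \<open>l + j < N\<close>. The surviving high frequencies are
  aliases of \<open>j\<close>, and absolute summability makes their contribution vanish as \<open>N\<close> grows, so that
  the averages converge to \<open>a 0\<close> or to \<open>a j / 2\<close> (\<open>grid_cosine_average_tendsto\<close>).

  The Gaussian process is the random Fourier series
  \<open>X t = (\<Sum>j. sqrt (a j) (\<xi> j cos (j t) + \<eta> j sin (j t)))\<close> with independent standard normal
  \<open>\<xi> j\<close> and \<open>\<eta> j\<close>, whose covariance is the cosine series by the addition formula again. Its partial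
  sums converge in mean square because \<open>a\<close> is summable; passing to a sparse subsequence of partial
  sums makes the increments so small that they converge almost surely (\<open>gaussian_series\<close>).
  Linear combinations stay normal in the limit because their characteristic functions converge, and
  the explicit variance of each linear combination determines the covariance by polarization
  (\<open>gaussian_process_of_centred_normal\<close>).\<close>

section \<open>Centred normal random variables\<close>

lemma normal_law_eq_scaled_std:
  assumes "0 \<le> \<sigma>"
  shows "normal_law 0 \<sigma> = distr std_normal_distribution borel (\<lambda>x. \<sigma> * x)"
proof -
  interpret N: real_distribution std_normal_distribution
    by (rule real_dist_normal_dist)
  show ?thesis
  proof (cases "\<sigma> = 0")
    case True
    then show ?thesis
      by (simp add: normal_law_def N.distr_const[of 0 borel])
  next
    case False
    have "distributed std_normal_distribution lborel (\<lambda>x. x) std_normal_density"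
      by (simp add: distributed_def distr_id2)
    then have "distributed std_normal_distribution lborel (\<lambda>x. 0 + \<sigma> * x)
        (normal_density (0 + \<sigma> * 0) (\<bar>\<sigma>\<bar> * 1))"
      using False by (intro N.normal_density_affine) auto
    then have "distr std_normal_distribution lborel (\<lambda>x. \<sigma> * x) = normal_law 0 \<sigma>"
      using False assms by (simp add: distributed_def normal_law_def)
    then show ?thesis
      by (metis distr_cong sets_lborel)
  qed
qed

lemma char_normal_law:
  assumes "0 \<le> \<sigma>"
  shows "char (normal_law 0 \<sigma>) t = exp (- (\<sigma>\<^sup>2 * t\<^sup>2) / 2)"
proof -
  have "char (normal_law 0 \<sigma>) t = char std_normal_distribution (t * \<sigma>)"
    unfolding normal_law_eq_scaled_std[OF assms] char_def
    by (subst integral_distr) (auto simp: mult_ac)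
  then show ?thesis
    by (simp add: char_std_normal_distribution power_mult_distrib mult_ac)
qed

lemma real_distribution_normal_law:
  assumes "0 \<le> \<sigma>"
  shows "real_distribution (normal_law 0 \<sigma>)"
proof -
  interpret N: real_distribution std_normal_distribution
    by (rule real_dist_normal_dist)
  show ?thesis
    unfolding normal_law_eq_scaled_std[OF assms] by (rule N.real_distribution_distr) simp
qed

text \<open>The parameter is the variance, not the standard deviation, because variances are what add up and
  converge below. The value \<open>0\<close> is included: singular covariances produce linear
  combinations that vanish almost surely.\<close>

definition centred_normal :: "'w measure \<Rightarrow> ('w \<Rightarrow> real) \<Rightarrow> real \<Rightarrow> bool" where
  "centred_normal M Y v \<longleftrightarrow>
     Y \<in> borel_measurable M \<and> 0 \<le> v \<and> distr M borel Y = normal_law 0 (sqrt v)"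

text \<open>By uniqueness of characteristic functions. This treats the degenerate law and the laws with a
  density uniformly, so that no later argument has to distinguish zero variance.\<close>

lemma (in prob_space) centred_normal_iff_char:
  "centred_normal M Y v \<longleftrightarrow> random_variable borel Y \<and> 0 \<le> v \<and>
     (\<forall>t. char (distr M borel Y) t = exp (- (v * t\<^sup>2) / 2))"
proof (intro iffI conjI allI; (elim conjE)?)
  assume *: "random_variable borel Y" "0 \<le> v"
    "\<forall>t. char (distr M borel Y) t = exp (- (v * t\<^sup>2) / 2)"
  then have "distr M borel Y = normal_law 0 (sqrt v)"
    by (intro Levy_uniqueness real_distribution_distr real_distribution_normal_law ext)
       (auto simp: char_normal_law)
  with * show "centred_normal M Y v"
    by (simp add: centred_normal_def)
qed (auto simp: centred_normal_def char_normal_law)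

lemma (in prob_space) centred_normal_moments:
  assumes "centred_normal M Y v"
  shows "integrable M Y" "expectation Y = 0"
    "integrable M (\<lambda>w. (Y w)\<^sup>2)" "expectation (\<lambda>w. (Y w)\<^sup>2) = v"
proof -
  have [measurable]: "random_variable borel Y" and v: "0 \<le> v"
    and Y: "distr M borel Y = distr std_normal_distribution borel (\<lambda>x. sqrt v * x)"
    using assms by (auto simp: centred_normal_def normal_law_eq_scaled_std)
  have int: "integrable M (\<lambda>w. f (Y w)) \<longleftrightarrow> integrable std_normal_distribution (\<lambda>x. f (sqrt v * x))"
    and lint: "expectation (\<lambda>w. f (Y w)) = (\<integral>x. f (sqrt v * x) \<partial>std_normal_distribution)"
    if [measurable]: "f \<in> borel_measurable borel" for f :: "real \<Rightarrow> real"
    using arg_cong[OF Y, of "\<lambda>N. integrable N f"] arg_cong[OF Y, of "\<lambda>N. integral\<^sup>L N f"]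
    by (simp_all add: integrable_distr_eq integral_distr)
  show "integrable M Y"
    using int[of "\<lambda>x. x"] integrable_std_normal_distribution_moment[of 1] by simp
  show "expectation Y = 0"
    using lint[of "\<lambda>x. x"] integral_std_normal_distribution_moment_odd[of 1] by simp
  show "integrable M (\<lambda>w. (Y w)\<^sup>2)"
    using int[of "\<lambda>x. x\<^sup>2"] integrable_std_normal_distribution_moment[of 2]
    by (simp add: power_mult_distrib)
  show "expectation (\<lambda>w. (Y w)\<^sup>2) = v"
    using lint[of "\<lambda>x. x\<^sup>2"] std_normal_distribution_even_moments(1)[of 1] v
    by (simp add: power_mult_distrib)
qed

lemma (in prob_space) centred_normal_sum_indep:
  assumes fin: "finite I" and indep: "indep_vars (\<lambda>_. borel) \<xi> I"
    and \<xi>: "\<And>i. i \<in> I \<Longrightarrow> centred_normal M (\<xi> i) 1"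
  shows "centred_normal M (\<lambda>w. \<Sum>i\<in>I. d i * \<xi> i w) (\<Sum>i\<in>I. (d i)\<^sup>2)"
  unfolding centred_normal_iff_char
proof (intro conjI allI)
  have [measurable]: "random_variable borel (\<xi> i)" if "i \<in> I" for i
    using \<xi>[OF that] by (simp add: centred_normal_def)
  show "random_variable borel (\<lambda>w. \<Sum>i\<in>I. d i * \<xi> i w)" "0 \<le> (\<Sum>i\<in>I. (d i)\<^sup>2)"
    by (auto intro!: sum_nonneg)
  fix t
  have "indep_vars (\<lambda>_. borel) (\<lambda>i w. d i * \<xi> i w) I"
    by (rule indep_vars_compose2[OF indep]) auto
  then have "char (distr M borel (\<lambda>w. \<Sum>i\<in>I. d i * \<xi> i w)) t
      = (\<Prod>i\<in>I. char (distr M borel (\<lambda>w. d i * \<xi> i w)) t)"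
    by (rule char_distr_sum)
  also have "\<dots> = (\<Prod>i\<in>I. char (distr M borel (\<xi> i)) (t * d i))"
    by (intro prod.cong) (auto simp: char_def integral_distr mult_ac)
  also have "\<dots> = (\<Prod>i\<in>I. of_real (exp (- ((d i)\<^sup>2 * t\<^sup>2) / 2)))"
    using \<xi> by (intro prod.cong) (auto simp: centred_normal_iff_char power_mult_distrib mult_ac)
  also have "\<dots> = of_real (exp (\<Sum>i\<in>I. - ((d i)\<^sup>2 * t\<^sup>2) / 2))"
    using fin by (simp only: exp_sum of_real_prod)
  also have "(\<Sum>i\<in>I. - ((d i)\<^sup>2 * t\<^sup>2) / 2) = - ((\<Sum>i\<in>I. (d i)\<^sup>2) * t\<^sup>2) / 2"
    by (simp add: sum_distrib_right sum_divide_distrib sum_negf)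
  finally show "char (distr M borel (\<lambda>w. \<Sum>i\<in>I. d i * \<xi> i w)) t
      = exp (- ((\<Sum>i\<in>I. (d i)\<^sup>2) * t\<^sup>2) / 2)" by simp
qed

text \<open>Dominated convergence carries almost sure convergence over to the characteristic functions, and
  the normal ones depend continuously on the variance.\<close>

lemma (in prob_space) centred_normal_AE_limit:
  assumes Y: "\<And>n. centred_normal M (Y n) (v n)"
    and Z [measurable]: "random_variable borel Z"
    and lim: "AE w in M. (\<lambda>n. Y n w) \<longlonglongrightarrow> Z w"
    and v: "v \<longlonglongrightarrow> v'"
  shows "centred_normal M Z v'"
  unfolding centred_normal_iff_char
proof (intro conjI allI)
  have [measurable]: "random_variable borel (Y n)" for n
    using Y[of n] by (simp add: centred_normal_def)
  show "0 \<le> v'"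
    using Y by (intro LIMSEQ_le_const[OF v]) (auto simp: centred_normal_def)
  fix t
  have "(\<lambda>n. CLINT w|M. iexp (t * Y n w)) \<longlonglongrightarrow> (CLINT w|M. iexp (t * Z w))"
  proof (rule integral_dominated_convergence[where w = "\<lambda>_. 1"])
    show "AE w in M. (\<lambda>n. iexp (t * Y n w)) \<longlonglongrightarrow> iexp (t * Z w)"
      using lim by eventually_elim (intro tendsto_intros)
  qed auto
  moreover have "(CLINT w|M. iexp (t * Y n w)) = exp (- (v n * t\<^sup>2) / 2)" for n
    using Y[of n] by (simp add: centred_normal_iff_char char_def integral_distr)
  ultimately have "(\<lambda>n. complex_of_real (exp (- (v n * t\<^sup>2) / 2)))
      \<longlonglongrightarrow> char (distr M borel Z) t"
    by (simp add: char_def integral_distr)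
  moreover have "(\<lambda>n. complex_of_real (exp (- (v n * t\<^sup>2) / 2)))
      \<longlonglongrightarrow> of_real (exp (- (v' * t\<^sup>2) / 2))"
    by (intro tendsto_intros v) auto
  ultimately show "char (distr M borel Z) t = exp (- (v' * t\<^sup>2) / 2)"
    by (rule LIMSEQ_unique)
qed simp

text \<open>The random series \<open>\<Sum>n. 2 ^ n * (D n)\<^sup>2\<close> has finite expectation, hence is almost surely finite,
  and it dominates \<open>\<Sum>n. \<bar>D n\<bar>\<close> up to a geometric series.\<close>

lemma (in prob_space) AE_summable_of_second_moments:
  fixes D :: "nat \<Rightarrow> 'a \<Rightarrow> real"
  assumes [measurable]: "\<And>n. random_variable borel (D n)"
    and int: "\<And>n. integrable M (\<lambda>w. (D n w)\<^sup>2)"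
    and le: "\<And>n. expectation (\<lambda>w. (D n w)\<^sup>2) \<le> (1/4) ^ n"
  shows "AE w in M. summable (\<lambda>n. D n w)"
proof -
  have "(\<integral>\<^sup>+w. (\<Sum>n. ennreal (2 ^ n * (D n w)\<^sup>2)) \<partial>M)
      = (\<Sum>n. \<integral>\<^sup>+w. ennreal (2 ^ n * (D n w)\<^sup>2) \<partial>M)"
    by (rule nn_integral_suminf) simp
  also have "\<dots> = (\<Sum>n. ennreal (2 ^ n * expectation (\<lambda>w. (D n w)\<^sup>2)))"
    by (intro suminf_cong, subst nn_integral_eq_integral) (auto intro: int)
  also have "\<dots> \<le> (\<Sum>n. ennreal ((1/2) ^ n))"
  proof (intro suminf_le ennreal_leI summableI)
    fix n
    have "2 ^ n * expectation (\<lambda>w. (D n w)\<^sup>2) \<le> 2 ^ n * (1/4) ^ n"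
      by (intro mult_left_mono le) simp
    also have "\<dots> = (1/2) ^ n"
      by (simp flip: power_mult_distrib)
    finally show "2 ^ n * expectation (\<lambda>w. (D n w)\<^sup>2) \<le> (1/2) ^ n" .
  qed
  also have "\<dots> = ennreal (\<Sum>n. (1/2) ^ n)"
    by (rule suminf_ennreal2) (auto intro: summable_geometric)
  also have "\<dots> < \<infinity>" by simp
  finally have "AE w in M. (\<Sum>n. ennreal (2 ^ n * (D n w)\<^sup>2)) \<noteq> \<infinity>"
    by (intro nn_integral_PInf_AE) auto
  then show ?thesis
  proof eventually_elim
    fix w assume "(\<Sum>n. ennreal (2 ^ n * (D n w)\<^sup>2)) \<noteq> \<infinity>"
    then have "summable (\<lambda>n. 2 ^ n * (D n w)\<^sup>2)"
      by (intro summable_suminf_not_top) auto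
    then have S: "summable (\<lambda>n. 2 ^ n * (D n w)\<^sup>2 + (1/2) ^ n)"
      by (intro summable_add summable_geometric) auto
    show "summable (\<lambda>n. D n w)"
    proof (rule summable_comparison_test'[OF S])
      fix n
      \<comment> \<open>\<open>2 x y \<le> x\<^sup>2 + y\<^sup>2\<close> with \<open>x = 2 ^ n * \<bar>D n w\<bar>\<close> and \<open>y = 1\<close>, divided by \<open>2 ^ n\<close>\<close>
      have "2 * (2 ^ n * \<bar>D n w\<bar>) \<le> (2 ^ n * \<bar>D n w\<bar>)\<^sup>2 + 1"
        using sum_squares_bound[of "2 ^ n * \<bar>D n w\<bar>" 1] by simp
      moreover have "0 \<le> 2 ^ n * \<bar>D n w\<bar>" by simp
      ultimately have "2 ^ n * \<bar>D n w\<bar> \<le> (2 ^ n * \<bar>D n w\<bar>)\<^sup>2 + 1"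
        by linarith
      also have "\<dots> = 2 ^ n * (2 ^ n * (D n w)\<^sup>2 + (1/2) ^ n)"
        by (simp add: power2_eq_square distrib_left mult_ac power_one_over)
      finally show "norm (D n w) \<le> 2 ^ n * (D n w)\<^sup>2 + (1/2) ^ n"
        by simp
    qed
  qed
qed

section \<open>Gaussian series\<close>

text \<open>The process is \<open>X t = (\<Sum>i. \<phi> t i * \<xi> i)\<close>, understood as the limit along a subsequence of partial
  sums. The majorant \<open>B\<close> is uniform in \<open>t\<close>, so one subsequence serves all \<open>t\<close> at once; then
  a linear combination of the \<open>X t\<close> is the limit of linear combinations of the \<open>\<xi> i\<close>, to which
  \<open>centred_normal_AE_limit\<close> applies. The exceptional null set may depend on \<open>t\<close>, which is harmless
  because each linear combination involves finitely many \<open>t\<close>.\<close>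

lemma (in prob_space) gaussian_series:
  fixes \<xi> :: "nat \<Rightarrow> 'a \<Rightarrow> real" and \<phi> :: "'i \<Rightarrow> nat \<Rightarrow> real"
  assumes \<xi>: "\<And>I d. finite I \<Longrightarrow> centred_normal M (\<lambda>w. \<Sum>i\<in>I. d i * \<xi> i w) (\<Sum>i\<in>I. (d i)\<^sup>2)"
    and \<phi>: "\<And>t i. t \<in> T \<Longrightarrow> (\<phi> t i)\<^sup>2 \<le> B i"
    and B: "summable B"
  obtains X where "\<And>F c. finite F \<Longrightarrow> F \<subseteq> T \<Longrightarrow>
    centred_normal M (\<lambda>w. \<Sum>t\<in>F. c t * X t w)
      (\<Sum>s\<in>F. \<Sum>t\<in>F. c s * c t * (\<Sum>i. \<phi> s i * \<phi> t i))"
proof -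
  have [measurable]: "random_variable borel (\<xi> i)" for i
    using \<xi>[of "{i}" "\<lambda>_. 1"] by (simp add: centred_normal_def)

  \<comment> \<open>Truncation points at which the tails of \<open>B\<close> decay like \<open>(1/4) ^ k\<close>, the rate that almost sure
     summability of the increments asks for.\<close>
  have "\<exists>r :: nat \<Rightarrow> nat. \<forall>k. (\<forall>m\<ge>r k. \<forall>n. norm (sum B {m..<n}) < (1/4) ^ k) \<and> r k < r (Suc k)"
  proof (rule dependent_nat_choice)
    show "\<exists>N. \<forall>m\<ge>N. \<forall>n. norm (sum B {m..<n}) < (1/4) ^ 0"
      using B by (simp add: summable_Cauchy)
  next
    fix N k :: nat
    obtain N' where "\<forall>m\<ge>N'. \<forall>n. norm (sum B {m..<n}) < (1/4) ^ Suc k"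
      using B unfolding summable_Cauchy by (metis zero_less_divide_1_iff zero_less_numeral zero_less_power)
    then show "\<exists>N'. (\<forall>m\<ge>N'. \<forall>n. norm (sum B {m..<n}) < (1/4) ^ Suc k) \<and> N < N'"
      by (intro exI[of _ "max N' (Suc N)"]) auto
  qed
  then obtain r :: "nat \<Rightarrow> nat"
    where tail: "\<And>k n. norm (sum B {r k..<n}) < (1/4) ^ k" and r: "\<And>k. r k < r (Suc k)"
    by blast
  have r_top: "filterlim r sequentially sequentially"
    using r by (intro filterlim_subseq strict_monoI_Suc)

  define S where "S k t w = (\<Sum>i<r k. \<phi> t i * \<xi> i w)" for k t w
  define X where "X t w = lim (\<lambda>k. S k t w)" for t w
  have [measurable]: "random_variable borel (S k t)" for k t
    unfolding S_def by measurable
  have [measurable]: "random_variable borel (X t)" for t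
    unfolding X_def by measurable

  have conv: "AE w in M. (\<lambda>k. S k t w) \<longlonglongrightarrow> X t w" if t: "t \<in> T" for t
  proof -
    define D where "D k w = (\<Sum>i\<in>{r k..<r (Suc k)}. \<phi> t i * \<xi> i w)" for k w
    have D: "centred_normal M (D k) (\<Sum>i\<in>{r k..<r (Suc k)}. (\<phi> t i)\<^sup>2)" for k
      unfolding D_def by (rule \<xi>) simp
    have D_eq: "D k w = S (Suc k) t w - S k t w" for k w
      using r[of k] sum_diff_nat_ivl[of 0 "r k" "r (Suc k)" "\<lambda>i. \<phi> t i * \<xi> i w"]
      by (simp add: D_def S_def lessThan_atLeast0)
    have "AE w in M. summable (\<lambda>k. D k w)"
    proof (rule AE_summable_of_second_moments)
      fix k
      show "random_variable borel (D k)"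
        unfolding D_def by measurable
      show "integrable M (\<lambda>w. (D k w)\<^sup>2)"
        by (rule centred_normal_moments[OF D])
      have "(\<Sum>i\<in>{r k..<r (Suc k)}. (\<phi> t i)\<^sup>2) \<le> sum B {r k..<r (Suc k)}"
        by (intro sum_mono \<phi> t)
      then show "expectation (\<lambda>w. (D k w)\<^sup>2) \<le> (1/4) ^ k"
        unfolding centred_normal_moments(4)[OF D]
        using tail[of k "r (Suc k)"] by (simp add: abs_less_iff)
    qed
    then show ?thesis
    proof eventually_elim
      fix w assume "summable (\<lambda>k. D k w)"
      then have "convergent (\<lambda>n. S 0 t w + (\<Sum>k<n. D k w))"
        by (intro convergent_add convergent_const) (simp add: summable_iff_convergent)
      moreover have "S 0 t w + (\<Sum>k<n. D k w) = S n t w" for n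
        using sum_lessThan_telescope[of "\<lambda>k. S k t w" n] by (simp add: D_eq)
      ultimately show "(\<lambda>k. S k t w) \<longlonglongrightarrow> X t w"
        by (simp add: X_def convergent_LIMSEQ_iff)
    qed
  qed

  show ?thesis
  proof (rule that)
    fix F c assume F: "finite F" "F \<subseteq> T"
    define d where "d i = (\<Sum>t\<in>F. c t * \<phi> t i)" for i
    show "centred_normal M (\<lambda>w. \<Sum>t\<in>F. c t * X t w)
        (\<Sum>s\<in>F. \<Sum>t\<in>F. c s * c t * (\<Sum>i. \<phi> s i * \<phi> t i))"
    proof (rule centred_normal_AE_limit)
      fix k
      have "(\<lambda>w. \<Sum>t\<in>F. c t * S k t w) = (\<lambda>w. \<Sum>i<r k. d i * \<xi> i w)"
        unfolding S_def d_def sum_distrib_left sum_distrib_right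
        by (subst sum.swap) (simp add: mult_ac)
      then show "centred_normal M (\<lambda>w. \<Sum>t\<in>F. c t * S k t w) (\<Sum>i<r k. (d i)\<^sup>2)"
        using \<xi>[of "{..<r k}" d] by simp
    next
      show "random_variable borel (\<lambda>w. \<Sum>t\<in>F. c t * X t w)" by measurable
      have "AE w in M. \<forall>t\<in>F. (\<lambda>k. S k t w) \<longlonglongrightarrow> X t w"
        using F conv by (intro AE_finite_allI) auto
      then show "AE w in M. (\<lambda>k. \<Sum>t\<in>F. c t * S k t w) \<longlonglongrightarrow> (\<Sum>t\<in>F. c t * X t w)"
        by eventually_elim (intro tendsto_intros, auto)
      have "summable (\<lambda>i. \<phi> s i * \<phi> t i)" if "s \<in> F" "t \<in> F" for s t
      proof (rule summable_comparison_test'[OF B])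
        fix i
        have "2 * \<bar>\<phi> s i * \<phi> t i\<bar> \<le> (\<phi> s i)\<^sup>2 + (\<phi> t i)\<^sup>2"
          using sum_squares_bound[of "\<bar>\<phi> s i\<bar>" "\<bar>\<phi> t i\<bar>"] by (simp add: abs_mult mult.assoc)
        also have "\<dots> \<le> 2 * B i"
          using \<phi>[of s i] \<phi>[of t i] that F by fastforce
        finally show "norm (\<phi> s i * \<phi> t i) \<le> B i" by simp
      qed
      then have "(\<lambda>i. \<Sum>s\<in>F. \<Sum>t\<in>F. c s * c t * (\<phi> s i * \<phi> t i)) sums
          (\<Sum>s\<in>F. \<Sum>t\<in>F. c s * c t * (\<Sum>i. \<phi> s i * \<phi> t i))"
        by (intro sums_sum sums_mult summable_sums)
      moreover have "(\<Sum>s\<in>F. \<Sum>t\<in>F. c s * c t * (\<phi> s i * \<phi> t i)) = (d i)\<^sup>2" for i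
        by (simp add: d_def power2_eq_square sum_product mult_ac)
      ultimately have "(\<lambda>i. (d i)\<^sup>2) sums
          (\<Sum>s\<in>F. \<Sum>t\<in>F. c s * c t * (\<Sum>i. \<phi> s i * \<phi> t i))" by simp
      then show "(\<lambda>k. \<Sum>i<r k. (d i)\<^sup>2) \<longlonglongrightarrow>
          (\<Sum>s\<in>F. \<Sum>t\<in>F. c s * c t * (\<Sum>i. \<phi> s i * \<phi> t i))"
        unfolding sums_def by (rule filterlim_compose[OF _ r_top])
    qed
  qed
qed

text \<open>The mean and the diagonal of the covariance come from single variables, the off-diagonal values
  from the variance of \<open>X s + X t\<close> by polarization.\<close>

lemma (in prob_space) gaussian_process_of_centred_normal:
  assumes lin: "\<And>F c. finite F \<Longrightarrow> F \<subseteq> T \<Longrightarrow>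
      centred_normal M (\<lambda>w. \<Sum>t\<in>F. c t * X t w) (\<Sum>s\<in>F. \<Sum>t\<in>F. c s * c t * K s t)"
    and sym: "\<And>s t. s \<in> T \<Longrightarrow> t \<in> T \<Longrightarrow> K s t = K t s"
  shows "gaussian_process M T X" "zero_mean_process M T X"
    "\<And>s t. s \<in> T \<Longrightarrow> t \<in> T \<Longrightarrow> covariance M (X s) (X t) = K s t"
proof -
  have single: "centred_normal M (X t) (K t t)" if "t \<in> T" for t
    using lin[of "{t}" "\<lambda>_. 1"] that by simp
  show "gaussian_process M T X"
    unfolding gaussian_process_def
  proof (intro conjI ballI allI impI)
    fix F c assume "finite F \<and> F \<subseteq> T"
    then have *: "centred_normal M (\<lambda>w. \<Sum>t\<in>F. c t * X t w) (\<Sum>s\<in>F. \<Sum>t\<in>F. c s * c t * K s t)"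
      by (intro lin) auto
    then show "\<exists>\<mu> \<sigma>. 0 \<le> \<sigma> \<and> distr M borel (\<lambda>w. \<Sum>t\<in>F. c t * X t w) = normal_law \<mu> \<sigma>"
      by (intro exI[of _ 0] exI[of _ "sqrt (\<Sum>s\<in>F. \<Sum>t\<in>F. c s * c t * K s t)"])
         (auto simp: centred_normal_def)
  qed (use single prob_space_axioms in \<open>auto simp: centred_normal_def\<close>)
  show "zero_mean_process M T X"
    using single centred_normal_moments(2) by (auto simp: zero_mean_process_def)
  fix s t assume st: "s \<in> T" "t \<in> T"
  note s = centred_normal_moments[OF single[OF st(1)]] and t = centred_normal_moments[OF single[OF st(2)]]
  have cov: "covariance M (X s) (X t) = expectation (\<lambda>w. X s w * X t w)"
    by (simp add: covariance_def s t)
  show "covariance M (X s) (X t) = K s t"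
  proof (cases "s = t")
    case True
    with cov t(4) show ?thesis by (simp add: power2_eq_square)
  next
    case False
    have "centred_normal M (\<lambda>w. X s w + X t w) (K s s + K t t + 2 * K s t)"
      using lin[of "{s, t}" "\<lambda>_. 1"] st False sym[OF st] by (simp add: algebra_simps)
    note st' = centred_normal_moments[OF this]
    have "X s w * X t w = ((X s w + X t w)\<^sup>2 - (X s w)\<^sup>2 - (X t w)\<^sup>2) / 2" for w
      by (simp add: power2_eq_square algebra_simps)
    then have "covariance M (X s) (X t) =
        expectation (\<lambda>w. ((X s w + X t w)\<^sup>2 - (X s w)\<^sup>2 - (X t w)\<^sup>2) / 2)"
      by (simp only: cov)
    also have "\<dots> =
        (expectation (\<lambda>w. (X s w + X t w)\<^sup>2) - expectation (\<lambda>w. (X s w)\<^sup>2)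
          - expectation (\<lambda>w. (X t w)\<^sup>2)) / 2"
      using s(3) t(3) st'(3) by simp
    finally show ?thesis
      using s(4) t(4) st'(4) by simp
  qed
qed

section \<open>Independent standard normal coordinates\<close>

text \<open>The index set is all of \<^typ>\<open>real\<close> because the process is to live on functions from reals to reals;
  the coordinates at natural numbers serve as the sequence \<open>\<xi>\<close> of the Gaussian series.\<close>

definition white_noise :: "(real \<Rightarrow> real) measure" where
  "white_noise = PiM UNIV (\<lambda>_. std_normal_distribution)"

lemma prob_space_white_noise: "prob_space white_noise"
  unfolding white_noise_def by (intro prob_space_PiM prob_space_normal_density) simp

lemma white_noise_linear_combination:
  fixes d :: "nat \<Rightarrow> real"
  assumes "finite I"
  shows "centred_normal white_noise (\<lambda>w. \<Sum>i\<in>I. d i * w (real i)) (\<Sum>i\<in>I. (d i)\<^sup>2)"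
proof -
  interpret P: product_prob_space "\<lambda>_::real. std_normal_distribution" UNIV
    by (intro product_prob_spaceI prob_space_normal_density) simp
  interpret W: prob_space white_noise
    by (rule prob_space_white_noise)
  have meas: "(\<lambda>w. w x) \<in> borel_measurable white_noise" for x
    unfolding white_noise_def by measurable
  have marginal: "distr white_noise borel (\<lambda>w. w x) = std_normal_distribution" for x
    using P.PiM_component[of x] unfolding white_noise_def
    by (simp cong: distr_cong)
  have "W.indep_vars (\<lambda>_. borel) (\<lambda>x w. w x) UNIV"
  proof (subst W.indep_vars_iff_distr_eq_PiM')
    have "distr white_noise (PiM UNIV (\<lambda>_. borel)) (\<lambda>w. \<lambda>x\<in>UNIV. w x) = distr white_noise white_noise (\<lambda>w. w)"
      unfolding white_noise_def by (intro distr_cong sets_PiM_cong) auto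
    also have "\<dots> = white_noise" by simp
    finally show "distr white_noise (PiM UNIV (\<lambda>_. borel)) (\<lambda>w. \<lambda>x\<in>UNIV. w x)
        = PiM UNIV (\<lambda>x. distr white_noise borel (\<lambda>w. w x))"
      unfolding marginal by (simp only: white_noise_def)
  qed (auto intro: meas)
  moreover have "centred_normal white_noise (\<lambda>w. w x) 1" for x
    by (simp add: centred_normal_def meas marginal normal_law_def)
  \<comment> \<open>The floor inverts the embedding of the natural numbers into the index set.\<close>
  ultimately have "centred_normal white_noise (\<lambda>w. \<Sum>x\<in>real ` I. d (nat \<lfloor>x\<rfloor>) * w x)
      (\<Sum>x\<in>real ` I. (d (nat \<lfloor>x\<rfloor>))\<^sup>2)"
    using assms by (intro W.centred_normal_sum_indep) (auto intro: W.indep_vars_subset)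
  then show "centred_normal white_noise (\<lambda>w. \<Sum>i\<in>I. d i * w (real i)) (\<Sum>i\<in>I. (d i)\<^sup>2)"
    by (simp add: sum.reindex)
qed

section \<open>Positive semi-definiteness and cosine coefficients\<close>

text \<open>The kernel \<open>cos (x (s - t)) = cos (x s) cos (x t) + sin (x s) sin (x t)\<close> is the Gram
  kernel of the points \<open>(cos (x s), sin (x s))\<close> in the plane.\<close>

lemma sum_sum_cos_diff:
  fixes b p :: "'i \<Rightarrow> real"
  shows "(\<Sum>i\<in>A. \<Sum>k\<in>A. b i * b k * cos (x * (p i - p k)))
    = (\<Sum>i\<in>A. b i * cos (x * p i))\<^sup>2 + (\<Sum>i\<in>A. b i * sin (x * p i))\<^sup>2"
  by (simp add: right_diff_distrib cos_diff power2_eq_square sum_product distrib_left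
      sum.distrib mult_ac)

text \<open>The summands are the powers of a nontrivial \<open>N\<close>-th root of unity.\<close>

lemma sum_cis_grid_angle:
  assumes "0 < k" "k < N"
  shows "(\<Sum>m<N. cis (real k * grid_angle N m)) = 0"
proof -
  define z where "z = cis (2 * pi * real k / real N)"
  have pow: "cis (real k * grid_angle N m) = z ^ m" for m
    by (simp add: z_def grid_angle_def Complex.DeMoivre mult_ac)
  have "z = exp (2 * of_real pi * \<i> * of_nat k / of_nat N)"
    by (simp add: z_def cis_conv_exp mult_ac)
  then have "z \<noteq> 1"
    using complex_root_unity_eq_1[of N k] assms by (auto dest: dvd_imp_le)
  moreover have "z ^ N = 1"
    using assms cis_multiple_2pi[of "real k"] by (simp add: z_def Complex.DeMoivre mult_ac)
  ultimately show ?thesis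
    by (simp add: pow sum_gp_strict)
qed

lemma sum_sum_cos_grid_angle:
  assumes "k < N"
  shows "(\<Sum>m<N. \<Sum>n<N. cos (real k * (grid_angle N m - grid_angle N n)))
    = (if k = 0 then (real N)\<^sup>2 else 0)"
proof (cases "k = 0")
  case False
  have "(\<Sum>m<N. cos (real k * grid_angle N m)) = 0" "(\<Sum>m<N. sin (real k * grid_angle N m)) = 0"
    using sum_cis_grid_angle[of k N] False assms
    by (simp_all add: complex_eq_iff)
  then show ?thesis
    using False sum_sum_cos_diff[of "\<lambda>_. 1" "real k" "grid_angle N" "{..<N}"] by simp
qed (simp add: power2_eq_square)

lemma psd_kernel_on_cos_series:
  fixes K :: "real \<Rightarrow> real"
  assumes series: "\<And>x y. x \<in> S \<Longrightarrow> y \<in> S \<Longrightarrow> (\<lambda>j. a j * cos (real j * (x - y))) sums K (x - y)"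
    and nonneg: "\<And>j. 0 \<le> a j"
  shows "psd_kernel_on S (\<lambda>x y. K (x - y))"
  unfolding psd_kernel_on_def
proof (intro allI impI)
  fix n and p b :: "nat \<Rightarrow> real"
  assume p: "\<forall>i\<in>{1..n}. p i \<in> S"
  have form: "(\<lambda>j. \<Sum>i=1..n. \<Sum>k=1..n. b i * b k * (a j * cos (real j * (p i - p k)))) sums
      (\<Sum>i=1..n. \<Sum>k=1..n. b i * b k * K (p i - p k))"
    using p by (intro sums_sum sums_mult series) auto
  have nonneg_term: "0 \<le> (\<Sum>i=1..n. \<Sum>k=1..n. b i * b k * (a j * cos (real j * (p i - p k))))" for j
  proof -
    have "(\<Sum>i=1..n. \<Sum>k=1..n. b i * b k * (a j * cos (real j * (p i - p k))))
        = a j * (\<Sum>i=1..n. \<Sum>k=1..n. b i * b k * cos (real j * (p i - p k)))"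
      by (simp add: sum_distrib_left mult_ac)
    then show ?thesis
      by (simp add: sum_sum_cos_diff nonneg)
  qed
  show "0 \<le> (\<Sum>i=1..n. \<Sum>k=1..n. b i * b k * K (p i - p k))"
    by (rule sums_le[OF nonneg_term sums_zero form])
qed

lemma quadratic_form_grid_mat:
  assumes "v \<in> carrier_vec N"
  shows "scalar_prod v (mult_mat_vec (grid_mat C N) v) =
    (\<Sum>m<N. \<Sum>n<N. vec_index v m * vec_index v n * C (grid_angle N m - grid_angle N n))"
  using assms
  by (simp add: scalar_prod_def grid_mat_def sum_distrib_left mult_ac lessThan_atLeast0)

text \<open>Evenness of \<open>C\<close> is what makes the matrix symmetric. The quadratic form is written over functions on
  the natural numbers instead of vectors, so that it has the same shape as for a kernel.\<close>

lemma psd_mat_grid_mat_iff: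
  assumes "\<And>t. C (- t) = C t"
  shows "psd_mat (grid_mat C N) \<longleftrightarrow>
    (\<forall>v. 0 \<le> (\<Sum>m<N. \<Sum>n<N. v m * v n * C (grid_angle N m - grid_angle N n)))"
proof -
  have "transpose_mat (grid_mat C N) = grid_mat C N"
    using assms by (intro eq_matI) (auto simp: grid_mat_def, metis minus_diff_eq)
  moreover have "square_mat (grid_mat C N)" "dim_row (grid_mat C N) = N"
    by (auto simp: grid_mat_def)
  ultimately have "psd_mat (grid_mat C N) \<longleftrightarrow>
      (\<forall>v\<in>carrier_vec N. 0 \<le> (\<Sum>m<N. \<Sum>n<N. vec_index v m * vec_index v n * C (grid_angle N m - grid_angle N n)))"
    by (simp add: psd_mat_def quadratic_form_grid_mat)
  also have "\<dots> \<longleftrightarrow> (\<forall>v. 0 \<le> (\<Sum>m<N. \<Sum>n<N. v m * v n * C (grid_angle N m - grid_angle N n)))"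
  proof (intro iffI allI)
    fix v :: "nat \<Rightarrow> real"
    assume "\<forall>v\<in>carrier_vec N. 0 \<le> (\<Sum>m<N. \<Sum>n<N. vec_index v m * vec_index v n * C (grid_angle N m - grid_angle N n))"
    from bspec[OF this, of "vec N v"]
    show "0 \<le> (\<Sum>m<N. \<Sum>n<N. v m * v n * C (grid_angle N m - grid_angle N n))"
      by simp
  qed simp
  finally show ?thesis .
qed

lemma grid_angle_in_Angles: "m < N \<Longrightarrow> grid_angle N m \<in> Angles"
  by (auto simp: grid_angle_def Angles_def field_simps)

lemma psd_mat_grid_mat_of_psd_kernel:
  assumes even: "\<And>t. C (- t) = C t"
    and psd: "psd_kernel_on Angles (\<lambda>x y. C (x - y))" and N: "1 \<le> N"
  shows "psd_mat (grid_mat C N)"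
  unfolding psd_mat_grid_mat_iff[of C, OF even]
proof
  fix v :: "nat \<Rightarrow> real"
  have "grid_angle N (i - 1) \<in> Angles" if "i \<in> {1..N}" for i
    using that by (intro grid_angle_in_Angles) auto
  then have "0 \<le> (\<Sum>i=1..N. \<Sum>k=1..N. v (i - 1) * v (k - 1) *
      C (grid_angle N (i - 1) - grid_angle N (k - 1)))"
    using psd[unfolded psd_kernel_on_def, rule_format, OF N,
        of "\<lambda>i. grid_angle N (i - 1)" "\<lambda>i. v (i - 1)"]
    by blast
  also have "\<dots> = (\<Sum>m<N. \<Sum>n<N. v m * v n * C (grid_angle N m - grid_angle N n))"
    by (simp add: sum.atLeast1_atMost_eq)
  finally show "0 \<le> (\<Sum>m<N. \<Sum>n<N. v m * v n * C (grid_angle N m - grid_angle N n))" .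
qed

text \<open>Discrete Fourier inversion with aliasing. The weight of \<open>a l\<close> in the average is bounded by \<open>1\<close> and
  is eventually constant in \<open>N\<close>, namely zero unless \<open>l = j\<close>; dominated convergence for series
  exchanges the limit with the sum over \<open>l\<close>. For \<open>j > 0\<close> the factor \<open>1/2\<close> is the mean
  of \<open>cos\<^sup>2\<close>.\<close>

lemma grid_cosine_average_tendsto:
  fixes a :: "nat \<Rightarrow> real"
  assumes series: "\<And>N m n. m < N \<Longrightarrow> n < N \<Longrightarrow>
      (\<lambda>l. a l * cos (real l * (grid_angle N m - grid_angle N n))) sums
        C (grid_angle N m - grid_angle N n)"
    and summable: "summable (\<lambda>l. \<bar>a l\<bar>)"
  shows "(\<lambda>N. (\<Sum>m<N. \<Sum>n<N. cos (real j * (grid_angle N m - grid_angle N n)) *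
      C (grid_angle N m - grid_angle N n)) / (real N)\<^sup>2)
    \<longlonglongrightarrow> (if j = 0 then a j else a j / 2)"
proof -
  define \<Delta> where "\<Delta> N m n = grid_angle N m - grid_angle N n" for N m n
  define W where "W N l = (\<Sum>m<N. \<Sum>n<N. cos (real j * \<Delta> N m n) * cos (real l * \<Delta> N m n)) / (real N)\<^sup>2"
    for N l
  define L where "L l = (if l = j then if j = 0 then 1 else 1/2 else 0 :: real)" for l
  have W_bound: "\<bar>W N l\<bar> \<le> 1" for N l
  proof -
    have "\<bar>\<Sum>m<N. \<Sum>n<N. cos (real j * \<Delta> N m n) * cos (real l * \<Delta> N m n)\<bar>
        \<le> (\<Sum>m<N. \<Sum>n<N. 1)"
      by (intro order_trans[OF sum_abs] sum_mono)
         (simp add: abs_mult mult_le_one)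
    then show ?thesis
      by (simp add: W_def divide_le_eq power2_eq_square)
  qed
  have W_eq: "W N l = L l" if "j + l < N" for N l
  proof -
    define k where "k = (if l \<le> j then j - l else l - j)"
    have k: "k < N" "k = 0 \<longleftrightarrow> l = j" using that by (auto simp: k_def)
    have "cos (real j * x) * cos (real l * x) = (cos (real k * x) + cos (real (j + l) * x)) / 2" for x
      using cos_minus[of "real j * x - real l * x"]
      by (simp add: cos_times_cos k_def of_nat_diff left_diff_distrib distrib_right)
    then have "W N l = ((\<Sum>m<N. \<Sum>n<N. cos (real k * \<Delta> N m n)) +
        (\<Sum>m<N. \<Sum>n<N. cos (real (j + l) * \<Delta> N m n))) / 2 / (real N)\<^sup>2"
      unfolding W_def by (simp only: sum.distrib sum_divide_distrib[symmetric])
    also have "\<dots> = L l"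
      using sum_sum_cos_grid_angle[OF k(1)] sum_sum_cos_grid_angle[OF that] k(2) that
      by (auto simp: \<Delta>_def L_def)
    finally show ?thesis .
  qed
  have "(\<lambda>N. \<Sum>l. a l * W N l) \<longlonglongrightarrow> (\<Sum>l. a l * L l)"
  proof (rule tannerys_theorem[THEN conjunct2, THEN conjunct2])
    fix l
    have "eventually (\<lambda>N. W N l = L l) sequentially"
      using eventually_gt_at_top[of "j + l"] by eventually_elim (rule W_eq)
    then have "(\<lambda>N. W N l) \<longlonglongrightarrow> L l"
      by (rule tendsto_eventually)
    then show "(\<lambda>N. a l * W N l) \<longlonglongrightarrow> a l * L l"
      by (rule tendsto_mult_left)
  next
    have "norm (a l * W N l) \<le> \<bar>a l\<bar>" for N l
      using mult_left_mono[OF W_bound[of N l], of "\<bar>a l\<bar>"] by (simp add: abs_mult)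
    then show "\<forall>\<^sub>F (l, N) in sequentially \<times>\<^sub>F sequentially. norm (a l * W N l) \<le> \<bar>a l\<bar>"
      by (intro always_eventually) auto
  qed (use summable in auto)
  moreover have "(\<Sum>l. a l * W N l) = (\<Sum>m<N. \<Sum>n<N. cos (real j * \<Delta> N m n) * C (\<Delta> N m n)) / (real N)\<^sup>2" for N
  proof -
    have "(\<lambda>l. (\<Sum>m<N. \<Sum>n<N. cos (real j * \<Delta> N m n) * (a l * cos (real l * \<Delta> N m n))) / (real N)\<^sup>2) sums
        ((\<Sum>m<N. \<Sum>n<N. cos (real j * \<Delta> N m n) * C (\<Delta> N m n)) / (real N)\<^sup>2)"
      unfolding \<Delta>_def by (intro sums_divide sums_sum sums_mult series) auto
    moreover have "(\<Sum>m<N. \<Sum>n<N. cos (real j * \<Delta> N m n) * (a l * cos (real l * \<Delta> N m n))) / (real N)\<^sup>2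
        = a l * W N l" for l
      by (simp add: W_def sum_distrib_left mult_ac)
    ultimately show ?thesis by (simp add: sums_iff)
  qed
  moreover have "(\<Sum>l. a l * L l) = (if j = 0 then a j else a j / 2)"
    by (subst suminf_finite[of "{j}"]) (auto simp: L_def)
  ultimately show ?thesis
    by (simp add: \<Delta>_def)
qed

text \<open>The double average is the sum of two quadratic forms of the grid matrix, evaluated at the real and
  imaginary parts of its Fourier eigenvector of frequency \<open>j\<close>.\<close>

lemma cosine_coefficient_nonneg_of_psd_grid:
  fixes a :: "nat \<Rightarrow> real"
  assumes even: "\<And>t. C (- t) = C t"
    and series: "\<And>N m n. m < N \<Longrightarrow> n < N \<Longrightarrow>
      (\<lambda>l. a l * cos (real l * (grid_angle N m - grid_angle N n))) sums
        C (grid_angle N m - grid_angle N n)"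
    and summable: "summable (\<lambda>l. \<bar>a l\<bar>)"
    and psd: "\<And>N. 1 \<le> N \<Longrightarrow> psd_mat (grid_mat C N)"
  shows "0 \<le> a j"
proof -
  have "0 \<le> (\<Sum>m<N. \<Sum>n<N. cos (real j * (grid_angle N m - grid_angle N n)) *
      C (grid_angle N m - grid_angle N n)) / (real N)\<^sup>2" if N: "1 \<le> N" for N
  proof -
    have form: "0 \<le> (\<Sum>m<N. \<Sum>n<N. v m * v n * C (grid_angle N m - grid_angle N n))" for v
      using psd[OF N] psd_mat_grid_mat_iff[of C, OF even] by blast
    have "(\<Sum>m<N. \<Sum>n<N. cos (real j * (grid_angle N m - grid_angle N n)) *
        C (grid_angle N m - grid_angle N n)) =
      (\<Sum>m<N. \<Sum>n<N. cos (real j * grid_angle N m) * cos (real j * grid_angle N n) * C (grid_angle N m - grid_angle N n)) +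
      (\<Sum>m<N. \<Sum>n<N. sin (real j * grid_angle N m) * sin (real j * grid_angle N n) * C (grid_angle N m - grid_angle N n))"
      by (simp add: right_diff_distrib cos_diff distrib_right sum.distrib)
    also have "\<dots> \<ge> 0"
      by (intro add_nonneg_nonneg form)
    finally show ?thesis by simp
  qed
  then have "0 \<le> (if j = 0 then a j else a j / 2)"
    by (intro LIMSEQ_le_const[OF grid_cosine_average_tendsto[OF series summable]]) auto
  then show ?thesis by (simp split: if_splits)
qed

section \<open>The random Fourier series and the equivalence\<close>

text \<open>The functions \<open>sqrt (a j) cos (j t)\<close> and \<open>sqrt (a j) sin (j t)\<close>, listed alternately, are the
  coefficients \<open>\<phi> t\<close> of a Gaussian series. Their squares are at most \<open>a j\<close>, whatever \<open>t\<close> is, and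
  the products for \<open>s\<close> and \<open>t\<close> add up to \<open>a j cos (j (s - t))\<close>.\<close>

lemma random_fourier_series:
  fixes a :: "nat \<Rightarrow> real"
  assumes nonneg: "\<And>j. 0 \<le> a j" and a: "summable a"
  obtains X :: "real \<Rightarrow> (real \<Rightarrow> real) \<Rightarrow> real" where "\<And>F c. finite F \<Longrightarrow>
    centred_normal white_noise (\<lambda>w. \<Sum>t\<in>F. c t * X t w)
      (\<Sum>s\<in>F. \<Sum>t\<in>F. c s * c t * (\<Sum>j. a j * cos (real j * (s - t))))"
proof -
  interpret W: prob_space white_noise
    by (rule prob_space_white_noise)
  define interleave where "interleave f g n = (if even n then f (n div 2) else g ((n - 1) div 2))"
    for f g :: "nat \<Rightarrow> real" and n
  define \<phi> where "\<phi> t = interleave (\<lambda>j. sqrt (a j) * cos (real j * t)) (\<lambda>j. sqrt (a j) * sin (real j * t))"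
    for t
  have interleave_sums: "interleave f g sums (x + y)" if "f sums x" "g sums y" for f g x y
    using sums_if[OF that(2) that(1)] by (simp add: interleave_def[abs_def] add.commute)
  have bound: "(\<phi> t n)\<^sup>2 \<le> interleave a a n" for t n
    using nonneg mult_left_mono[OF abs_cos_le_one[THEN power_mono[of _ 1 2]] nonneg]
      mult_left_mono[OF abs_sin_le_one[THEN power_mono[of _ 1 2]] nonneg]
    by (simp add: \<phi>_def interleave_def power_mult_distrib)
  have B: "summable (interleave a a)"
    using interleave_sums[of a _ a] a by (auto simp: summable_def)
  have kernel: "(\<Sum>n. \<phi> s n * \<phi> t n) = (\<Sum>j. a j * cos (real j * (s - t)))" for s t
  proof -
    define f where "f j = a j * (cos (real j * s) * cos (real j * t))" for j
    define g where "g j = a j * (sin (real j * s) * sin (real j * t))" for j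
    have "\<bar>f j\<bar> \<le> a j" "\<bar>g j\<bar> \<le> a j" for j
      using nonneg[of j] by (auto simp: f_def g_def abs_mult intro!: mult_left_le mult_le_one)
    then have "summable f" "summable g"
      by (auto intro: summable_comparison_test'[OF a])
    then have "interleave f g sums (suminf f + suminf g)" "(\<lambda>j. f j + g j) sums (suminf f + suminf g)"
      by (auto intro!: interleave_sums sums_add summable_sums)
    moreover have "(\<lambda>n. \<phi> s n * \<phi> t n) = interleave f g"
      using nonneg by (auto simp: interleave_def \<phi>_def f_def g_def)
    moreover have "f j + g j = a j * cos (real j * (s - t))" for j
      by (simp add: f_def g_def right_diff_distrib cos_diff distrib_left)
    ultimately show ?thesis
      by (simp add: sums_iff)
  qed
  show ?thesis
  proof (rule W.gaussian_series[OF white_noise_linear_combination bound B, of UNIV])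
    fix X :: "real \<Rightarrow> (real \<Rightarrow> real) \<Rightarrow> real"
    assume "\<And>F c. finite F \<Longrightarrow> F \<subseteq> UNIV \<Longrightarrow> centred_normal white_noise (\<lambda>w. \<Sum>t\<in>F. c t * X t w)
      (\<Sum>s\<in>F. \<Sum>t\<in>F. c s * c t * (\<Sum>n. \<phi> s n * \<phi> t n))"
    then show ?thesis
      by (intro that[of X]) (simp add: kernel)
  qed
qed

lemma even_periodic_eq_ang_dist:
  assumes even: "\<And>t. C (- t) = C t" and periodic: "\<And>t. C (t + 2 * pi) = C t"
  shows "C (x - y) = C (ang_dist x y)"
proof -
  have "C \<bar>x - y\<bar> = C (x - y)"
    using even[of "x - y"] by (simp add: abs_if)
  moreover have "C (2 * pi - \<bar>x - y\<bar>) = C \<bar>x - y\<bar>"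
    using periodic[of "- \<bar>x - y\<bar>"] even[of "\<bar>x - y\<bar>"] by (simp add: add.commute)
  ultimately show ?thesis
    by (simp add: ang_dist_def min_def)
qed

theorem theorem2p1:
  fixes C :: "real \<Rightarrow> real" and a :: "nat \<Rightarrow> real"
  assumes even: "\<And>t. C (- t) = C t"
    and periodic: "\<And>t. C (t + 2 * pi) = C t"
    and a_0: "a 0 = 1 / (2 * pi) * integral {0..2 * pi} C"
    and a_j: "\<And>j. j \<ge> 1 \<Longrightarrow> a j = 1 / pi * integral {0..2 * pi} (\<lambda>t. C t * cos (real j * t))"
    and summable: "summable (\<lambda>j. \<bar>a j\<bar>)"
    and cosine_series: "\<And>t. t \<in> {0..2 * pi} \<Longrightarrow>
          (\<lambda>j. a (Suc j) * cos (real (Suc j) * t)) sums (C t - a 0)"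
  shows "(psd_kernel_on Angles (\<lambda>x y. C (x - y)) \<longleftrightarrow> (\<forall>N\<ge>1. psd_mat (grid_mat C N)))
    \<and> ((\<forall>N\<ge>1. psd_mat (grid_mat C N)) \<longleftrightarrow> (\<forall>j. a j \<ge> 0))
    \<and> (psd_kernel_on Angles (\<lambda>x y. C (x - y)) \<or> (\<forall>N\<ge>1. psd_mat (grid_mat C N)) \<or> (\<forall>j. a j \<ge> 0)
        \<longrightarrow> valid_covariance_on Angles (\<lambda>x y. C (x - y))
          \<and> (\<exists>(M :: (real \<Rightarrow> real) measure) (X :: real \<Rightarrow> (real \<Rightarrow> real) \<Rightarrow> real).
                gaussian_process M Angles X \<and> zero_mean_process M Angles X
                \<and> stationary_on_circle M X
                \<and> (\<forall>x\<in>Angles. \<forall>y\<in>Angles. covariance M (X x) (X y) = C (x - y))))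
    \<and> (\<forall>x\<in>Angles. \<forall>y\<in>Angles. C (x - y) = C (ang_dist x y))"
proof -
  \<comment> \<open>Differences of angles may be negative, where the series is not given; both sides are even.\<close>
  have series: "(\<lambda>j. a j * cos (real j * (x - y))) sums C (x - y)"
    if "x \<in> Angles" "y \<in> Angles" for x y
  proof -
    have "\<bar>x - y\<bar> \<in> {0..2 * pi}"
      using that by (auto simp: Angles_def)
    from cosine_series[OF this] have "(\<lambda>j. a j * cos (real j * \<bar>x - y\<bar>)) sums C \<bar>x - y\<bar>"
      using sums_Suc_iff[of "\<lambda>j. a j * cos (real j * \<bar>x - y\<bar>)" "C \<bar>x - y\<bar> - a 0"] by simp
    moreover have "C \<bar>x - y\<bar> = C (x - y)"
      using even[of "x - y"] by (simp add: abs_if)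
    moreover have "cos (real j * \<bar>x - y\<bar>) = cos (real j * (x - y))" for j
      using cos_minus[of "real j * (x - y)"] by (simp add: abs_if right_diff_distrib)
    ultimately show ?thesis by simp
  qed
  have dist: "C (x - y) = C (ang_dist x y)" for x y
    by (rule even_periodic_eq_ang_dist[of C, OF even periodic])

  have i_ii: "\<forall>N\<ge>1. psd_mat (grid_mat C N)" if "psd_kernel_on Angles (\<lambda>x y. C (x - y))"
    using psd_mat_grid_mat_of_psd_kernel[of C] even that by blast
  have ii_iii: "\<forall>j. 0 \<le> a j" if "\<forall>N\<ge>1. psd_mat (grid_mat C N)"
  proof
    fix j
    show "0 \<le> a j"
      by (rule cosine_coefficient_nonneg_of_psd_grid[of C a])
         (use even that summable in \<open>auto intro!: series grid_angle_in_Angles\<close>)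
  qed
  have iii_i: "psd_kernel_on Angles (\<lambda>x y. C (x - y))" if "\<forall>j. 0 \<le> a j"
    using psd_kernel_on_cos_series[of Angles a C] series that by blast

  have process: "valid_covariance_on Angles (\<lambda>x y. C (x - y))
      \<and> (\<exists>(M :: (real \<Rightarrow> real) measure) (X :: real \<Rightarrow> (real \<Rightarrow> real) \<Rightarrow> real).
            gaussian_process M Angles X \<and> zero_mean_process M Angles X
            \<and> stationary_on_circle M X
            \<and> (\<forall>x\<in>Angles. \<forall>y\<in>Angles. covariance M (X x) (X y) = C (x - y)))"
    if nonneg: "\<forall>j. 0 \<le> a j"
  proof (intro conjI)
    have sym: "C (x - y) = C (y - x)" for x y
      using even[of "x - y"] by simp
    then show "valid_covariance_on Angles (\<lambda>x y. C (x - y))"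
      using iii_i[OF nonneg] by (simp add: valid_covariance_on_def)
    interpret W: prob_space white_noise
      by (rule prob_space_white_noise)
    have "summable a"
      using summable nonneg by simp
    then obtain X :: "real \<Rightarrow> (real \<Rightarrow> real) \<Rightarrow> real" where X: "\<And>F c. finite F \<Longrightarrow>
        centred_normal white_noise (\<lambda>w. \<Sum>t\<in>F. c t * X t w)
          (\<Sum>s\<in>F. \<Sum>t\<in>F. c s * c t * (\<Sum>j. a j * cos (real j * (s - t))))"
      using random_fourier_series[of a] nonneg by blast
    have lin: "centred_normal white_noise (\<lambda>w. \<Sum>t\<in>F. c t * X t w)
        (\<Sum>s\<in>F. \<Sum>t\<in>F. c s * c t * C (s - t))" if F: "finite F" "F \<subseteq> Angles" for F c
    proof -
      have "(\<Sum>s\<in>F. \<Sum>t\<in>F. c s * c t * (\<Sum>j. a j * cos (real j * (s - t))))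
          = (\<Sum>s\<in>F. \<Sum>t\<in>F. c s * c t * C (s - t))"
        using F(2) by (intro sum.cong refl) (simp add: subset_iff sums_unique[OF series, symmetric])
      with X[OF F(1), of c] show ?thesis by simp
    qed
    note gp = W.gaussian_process_of_centred_normal[of Angles X "\<lambda>s t. C (s - t)", OF lin sym]
    have "stationary_on_circle white_noise X"
      unfolding stationary_on_circle_def
    proof (intro conjI)
      show "\<exists>m. \<forall>x\<in>Angles. (\<integral>w. X x w \<partial>white_noise) = m"
        using gp(2) by (auto simp: zero_mean_process_def)
      show "\<exists>R. \<forall>x\<in>Angles. \<forall>y\<in>Angles. covariance white_noise (X x) (X y) = R (ang_dist x y)"
        using gp(3) dist by (intro exI[of _ C]) simp
    qed
    with gp show "\<exists>(M :: (real \<Rightarrow> real) measure) (X :: real \<Rightarrow> (real \<Rightarrow> real) \<Rightarrow> real).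
        gaussian_process M Angles X \<and> zero_mean_process M Angles X
        \<and> stationary_on_circle M X
        \<and> (\<forall>x\<in>Angles. \<forall>y\<in>Angles. covariance M (X x) (X y) = C (x - y))"
      by (intro exI[of _ white_noise] exI[of _ X]) auto
  qed

  show ?thesis
    using i_ii ii_iii iii_i process dist by blast
qed

end
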